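(* Let $A$ be a finite dimensional commutative $\mathbb{Q}$-algebra with unit element $1_A$. (a) Let $L_1,L_2\in\mathcal{L}(A)$ with $L_1\sim_w L_2$ (in the semigroup $\mathcal{L}(A)$). Then $\mathcal{O}(L_1)=\mathcal{O}(L_2)$. The only full lattice $L_3$ with $L_1L_3=L_2$ and $L_3\in G(\mathcal{O}(L_1))$ is $L_3=L_2:L_1$. (b) Let $\Lambda$ be an order in $A$ and $L_1\in\mathcal{L}(A)$ with $\mathcal{O}(L_1)=\Lambda$. Then $$G(\Lambda)=[\Lambda]_w\quad\text{and}\quad G([\Lambda]_\varepsilon)=[[\Lambda]_\varepsilon]_w .$$ The maps $$G(\Lambda)\to[L_1]_w,\ L_3\mapsto L_3L_1,\qquad G([\Lambda]_\varepsilon)\to[[L_1]_\varepsilon]_w,\ [L_3]_\varepsilon\mapsto[L_3]_\varepsilon[L_1]_\varepsilon,$$ are well defined and are bijections.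
   Context: A full lattice in $A$ is a finitely generated $\mathbb{Z}$-submodule of $A$ which generates $A$ over $\mathbb{Q}$; $\mathcal{L}(A)$ is the set of full lattices. For $L_1,L_2\in\mathcal{L}(A)$, $L_1L_2$ is the set of finite sums $\sum_i a_ib_i$ with $a_i\in L_1,b_i\in L_2$, and $L_1:L_2:=\{a\in A\mid aL_2\subset L_1\}$; both are full lattices, and $\mathcal{L}(A)$ is a commutative semigroup under multiplication. An order in $A$ is a full lattice $\Lambda$ with $1_A\in\Lambda$, $\Lambda\Lambda\subset\Lambda$. The order of $L$ is $\mathcal{O}(L):=L:L$. $L_1\sim_\varepsilon L_2$ iff $aL_1=L_2$ for some unit $a$ of $A$; $[L]_\varepsilon$ denotes the class and $\mathcal{E}(A):=\mathcal{L}(A)/\sim_\varepsilon$ is a commutative semigroup with the induced multiplication. In a commutative semigroup $S$: $c$ is idempotent if $cc=c$; $a\in S$ is invertible if there are $b,c\in S$ with $ab=c$, $ac=a$; then $c$ is unique, idempotent, and denoted $e_a$. For $c$ idempotent, $G(c):=\{a\in S\mid a \text{ invertible}, e_a=c\}$, a group with unit $c$. The idempotents of $\mathcal{L}(A)$ are the orders; the idempotents of $\mathcal{E}(A)$ are the $\varepsilon$-classes of orders. $G(\Lambda)$ is formed in $\mathcal{L}(A)$ and $G([\Lambda]_\varepsilon)$ in $\mathcal{E}(A)$. The $w$-equivalence on $S$: $a\sim_w b$ iff $a=b$ or there exist $x_1,x_2\in S$ with $ax_1=b$, $bx_2=a$. $[a]_w$ denotes the $w$-class of $a$ in $S$; $[L]_w$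 is formed in $\mathcal{L}(A)$ and $[[L]_\varepsilon]_w$ in $\mathcal{E}(A)$. *)

theory Defs
  imports Complex_Main
begin

section \<open>Commutative semigroups given by a carrier and a multiplication\<close>

definition sg_invertible :: "'s set \<Rightarrow> ('s \<Rightarrow> 's \<Rightarrow> 's) \<Rightarrow> 's \<Rightarrow> bool" where
  "sg_invertible S m a \<longleftrightarrow> a \<in> S \<and> (\<exists>b\<in>S. \<exists>c\<in>S. m a b = c \<and> m a c = a)"

definition sg_unit_of :: "'s set \<Rightarrow> ('s \<Rightarrow> 's \<Rightarrow> 's) \<Rightarrow> 's \<Rightarrow> 's" where
  "sg_unit_of S m a = (THE c. c \<in> S \<and> (\<exists>b\<in>S. m a b = c \<and> m a c = a))"

text \<open>The group with unit \<open>c\<close>; intended for idempotent \<open>c\<close>.\<close>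

definition sg_group :: "'s set \<Rightarrow> ('s \<Rightarrow> 's \<Rightarrow> 's) \<Rightarrow> 's \<Rightarrow> 's set" where
  "sg_group S m c = {a. sg_invertible S m a \<and> sg_unit_of S m a = c}"

definition sg_w_equiv :: "'s set \<Rightarrow> ('s \<Rightarrow> 's \<Rightarrow> 's) \<Rightarrow> 's \<Rightarrow> 's \<Rightarrow> bool" where
  "sg_w_equiv S m a b \<longleftrightarrow>
     a \<in> S \<and> b \<in> S \<and> (a = b \<or> (\<exists>x1\<in>S. \<exists>x2\<in>S. m a x1 = b \<and> m b x2 = a))"

definition sg_w_class :: "'s set \<Rightarrow> ('s \<Rightarrow> 's \<Rightarrow> 's) \<Rightarrow> 's \<Rightarrow> 's set" where
  "sg_w_class S m a = {b. sg_w_equiv S m a b}"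

text \<open>In a commutative semigroup the description in \<^const>\<open>sg_unit_of\<close> is definite.\<close>

lemma sg_unit_of_unique:
  assumes assoc: "\<And>x y z. x \<in> S \<Longrightarrow> y \<in> S \<Longrightarrow> z \<in> S \<Longrightarrow> m (m x y) z = m x (m y z)"
    and comm: "\<And>x y. x \<in> S \<Longrightarrow> y \<in> S \<Longrightarrow> m x y = m y x"
    and inv: "sg_invertible S m a"
  shows "\<exists>!c. c \<in> S \<and> (\<exists>b\<in>S. m a b = c \<and> m a c = a)"
proof -
  have *: "m c c' = c'"
    if "a \<in> S" "b \<in> S" "c \<in> S" "b' \<in> S" "c' \<in> S"
      "m a b = c" "m a c = a" "m a b' = c'" "m a c' = a" for b c b' c'
    using that assoc[of c a b'] comm[of c a] by simp
  show ?thesis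
    using inv unfolding sg_invertible_def by (metis * comm)
qed

section \<open>Finite dimensional commutative algebras over the rationals\<close>

text \<open>
  The sort avoids \<^class>\<open>comm_ring_1\<close>, which demands \<open>0 \<noteq> 1\<close>
  and so would exclude the zero algebra.
\<close>

locale fin_dim_comm_rat_algebra = vector_space scale
  for scale :: "rat \<Rightarrow> 'a::{comm_ring, comm_monoid_mult} \<Rightarrow> 'a" +
  assumes scale_mult_left: "scale q (x * y) = scale q x * y"
    and finite_dim: "\<exists>B. finite B \<and> module.span scale B = UNIV"
begin

sublocale int_module: module "\<lambda>n::int. scale (of_int n)"
  by unfold_locales (simp_all add: scale_right_distrib scale_left_distrib)

end

text \<open>The first span is over the integers (finitely generated), the second over the rationals.\<close>

definition full_lattices :: "(rat \<Rightarrow> 'a::{comm_ring, comm_monoid_mult} \<Rightarrow> 'a) \<Rightarrow> 'a set set" where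
  "full_lattices scale =
     {L. (\<exists>B. finite B \<and> L = module.span (\<lambda>n::int. scale (of_int n)) B)
         \<and> module.span scale L = UNIV}"

definition lat_mult :: "'a::{comm_ring, comm_monoid_mult} set \<Rightarrow> 'a set \<Rightarrow> 'a set" where
  "lat_mult L1 L2 =
     {(\<Sum>i<n. a i * b i) | (n::nat) a b. (\<forall>i<n. a i \<in> L1 \<and> b i \<in> L2)}"

definition lat_quot :: "'a::{comm_ring, comm_monoid_mult} set \<Rightarrow> 'a set \<Rightarrow> 'a set" where
  "lat_quot L1 L2 = {a. (*) a ` L2 \<subseteq> L1}"

definition lat_order :: "'a::{comm_ring, comm_monoid_mult} set \<Rightarrow> 'a set" where
  "lat_order L = lat_quot L L"

definition is_order :: "(rat \<Rightarrow> 'a::{comm_ring, comm_monoid_mult} \<Rightarrow> 'a) \<Rightarrow> 'a set \<Rightarrow> bool" where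
  "is_order scale \<Lambda> \<longleftrightarrow>
     \<Lambda> \<in> full_lattices scale \<and> 1 \<in> \<Lambda> \<and> lat_mult \<Lambda> \<Lambda> \<subseteq> \<Lambda>"

definition eps_rel :: "(rat \<Rightarrow> 'a::{comm_ring, comm_monoid_mult} \<Rightarrow> 'a) \<Rightarrow> ('a set \<times> 'a set) set" where
  "eps_rel scale = {(L1, L2). L1 \<in> full_lattices scale \<and> L2 \<in> full_lattices scale
     \<and> (\<exists>a. a dvd 1 \<and> (*) a ` L1 = L2)}"

definition eps_class :: "(rat \<Rightarrow> 'a::{comm_ring, comm_monoid_mult} \<Rightarrow> 'a) \<Rightarrow> 'a set \<Rightarrow> 'a set set" where
  "eps_class scale L = eps_rel scale `` {L}"

definition eps_classes :: "(rat \<Rightarrow> 'a::{comm_ring, comm_monoid_mult} \<Rightarrow> 'a) \<Rightarrow> 'a set set set" where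
  "eps_classes scale = full_lattices scale // eps_rel scale"

text \<open>
  The induced multiplication on classes: all the classes in the union coincide,
  as \<open>eps_mult_eps_class\<close> below shows.
\<close>

definition eps_mult :: "(rat \<Rightarrow> 'a::{comm_ring, comm_monoid_mult} \<Rightarrow> 'a) \<Rightarrow>
    'a set set \<Rightarrow> 'a set set \<Rightarrow> 'a set set" where
  "eps_mult scale X Y = (\<Union>L1\<in>X. \<Union>L2\<in>Y. eps_class scale (lat_mult L1 L2))"

lemma lat_mult_scaled:
  "lat_mult ((*) a ` L1) ((*) b ` L2) = (*) (a * b) ` lat_mult L1 L2"
proof (rule subset_antisym; rule subsetI)
  fix x assume "x \<in> lat_mult ((*) a ` L1) ((*) b ` L2)"
  then obtain n :: nat and u v where uv: "\<forall>i<n. u i \<in> (*) a ` L1 \<and> v i \<in> (*) b ` L2"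
    and x: "x = (\<Sum>i<n. u i * v i)"
    unfolding lat_mult_def by blast
  then have "\<forall>i. \<exists>p. i < n \<longrightarrow> fst p \<in> L1 \<and> snd p \<in> L2 \<and> u i = a * fst p \<and> v i = b * snd p"
    by (metis (no_types, lifting) fst_conv imageE snd_conv)
  then obtain p where p: "\<And>i. i < n \<Longrightarrow>
      fst (p i) \<in> L1 \<and> snd (p i) \<in> L2 \<and> u i = a * fst (p i) \<and> v i = b * snd (p i)"
    by metis
  have "x = (\<Sum>i<n. (a * b) * (fst (p i) * snd (p i)))"
    unfolding x by (intro sum.cong refl) (simp add: p mult_ac)
  also have "\<dots> = (a * b) * (\<Sum>i<n. fst (p i) * snd (p i))"
    by (simp add: sum_distrib_left)
  finally show "x \<in> (*) (a * b) ` lat_mult L1 L2"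
    unfolding lat_mult_def
    using p by (intro image_eqI CollectI exI conjI) auto
next
  fix x assume "x \<in> (*) (a * b) ` lat_mult L1 L2"
  then obtain n :: nat and u v where uv: "\<forall>i<n. u i \<in> L1 \<and> v i \<in> L2"
    and x: "x = (a * b) * (\<Sum>i<n. u i * v i)"
    unfolding lat_mult_def by blast
  have "x = (\<Sum>i<n. (a * u i) * (b * v i))"
    unfolding x by (simp add: sum_distrib_left mult_ac)
  then show "x \<in> lat_mult ((*) a ` L1) ((*) b ` L2)"
    unfolding lat_mult_def using uv
    by (intro CollectI exI[of _ n] exI[of _ "\<lambda>i. a * u i"] exI[of _ "\<lambda>i. b * v i"]) auto
qed

lemma equiv_eps_rel: "equiv (full_lattices scale) (eps_rel scale)"
proof (rule equivI)
  show "eps_rel scale \<subseteq> full_lattices scale \<times> full_lattices scale"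
    by (auto simp: eps_rel_def)
  show "refl_on (full_lattices scale) (eps_rel scale)"
    by (auto simp: refl_on_def eps_rel_def intro!: exI[of _ 1])
  show "sym (eps_rel scale)"
  proof (rule symI)
    fix L1 L2 assume "(L1, L2) \<in> eps_rel scale"
    then obtain a b where "L1 \<in> full_lattices scale" "L2 \<in> full_lattices scale"
      and ab: "1 = a * b" and L2: "(*) a ` L1 = L2"
      unfolding eps_rel_def dvd_def by blast
    moreover have "(*) b ` L2 = L1"
      unfolding L2[symmetric] image_image
      by (simp add: mult.assoc[symmetric] mult.commute[of b a] ab[symmetric])
    moreover have "b dvd 1"
      unfolding dvd_def using ab mult.commute[of a b] by metis
    ultimately show "(L2, L1) \<in> eps_rel scale"
      unfolding eps_rel_def by blast
  qed
  show "trans (eps_rel scale)"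
  proof (rule transI)
    fix L1 L2 L3 assume "(L1, L2) \<in> eps_rel scale" "(L2, L3) \<in> eps_rel scale"
    then obtain a a' b b' where L: "L1 \<in> full_lattices scale" "L3 \<in> full_lattices scale"
      and ab: "1 = a * a'" "1 = b * b'" and "(*) a ` L1 = L2" "(*) b ` L2 = L3"
      unfolding eps_rel_def dvd_def by blast
    then have "(*) (b * a) ` L1 = L3"
      by (auto simp: image_image mult.assoc)
    moreover have "(b * a) * (a' * b') = b * ((a * a') * b')"
      by (simp add: mult_ac)
    then have "1 = (b * a) * (a' * b')"
      by (simp add: ab[symmetric])
    then have "b * a dvd 1"
      unfolding dvd_def by blast
    ultimately show "(L1, L3) \<in> eps_rel scale"
      unfolding eps_rel_def using L by blast
  qed
qed

context fin_dim_comm_rat_algebra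
begin

lemma scale_mult_right: "scale q (x * y) = x * scale q y"
  using scale_mult_left[of q y x] by (simp add: mult.commute)

lemma lat_mult_full_lattice:
  assumes "L1 \<in> full_lattices scale" "L2 \<in> full_lattices scale"
  shows "lat_mult L1 L2 \<in> full_lattices scale"
proof -
  obtain B1 B2 where B: "finite B1" "L1 = int_module.span B1" "finite B2" "L2 = int_module.span B2"
    and sp: "span L1 = UNIV" "span L2 = UNIV"
    using assms unfolding full_lattices_def by blast
  let ?P = "(\<lambda>(x, y). x * y) ` (B1 \<times> B2)"
  have prod_in: "x * y \<in> int_module.span ?P" if "x \<in> L1" "y \<in> L2" for x y
    using \<open>x \<in> L1\<close> unfolding B
  proof (induction rule: int_module.span_induct_alt)
    case base
    show ?case by (simp add: int_module.span_zero)
  next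
    case (step c u v)
    have "u * y \<in> int_module.span ?P"
      using \<open>y \<in> L2\<close> unfolding B
    proof (induction rule: int_module.span_induct_alt)
      case base
      show ?case by (simp add: int_module.span_zero)
    next
      case (step d s t)
      have "u * s \<in> int_module.span ?P"
        using step \<open>u \<in> B1\<close> by (intro int_module.span_base) auto
      then show ?case
        using step int_module.span_scale[of "u * s" ?P d]
        by (simp add: distrib_left scale_mult_right[symmetric] int_module.span_add)
    qed
    then show ?case
      using step int_module.span_scale[of "u * y" ?P c]
      by (simp add: distrib_right scale_mult_left[symmetric] int_module.span_add)
  qed
  have single: "x * y \<in> lat_mult L1 L2" if "x \<in> L1" "y \<in> L2" for x y
    unfolding lat_mult_def using that
    by (intro CollectI exI[of _ "Suc 0"] exI[of _ "\<lambda>_. x"] exI[of _ "\<lambda>_. y"]) auto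
  have add: "u + v \<in> lat_mult L1 L2" if uv: "u \<in> lat_mult L1 L2" "v \<in> lat_mult L1 L2" for u v
  proof -
    obtain n k :: nat and a b c d where
      u: "\<forall>i<n. a i \<in> L1 \<and> b i \<in> L2" "u = (\<Sum>i<n. a i * b i)" and
      v: "\<forall>i<k. c i \<in> L1 \<and> d i \<in> L2" "v = (\<Sum>i<k. c i * d i)"
      using uv unfolding lat_mult_def by blast
    let ?a = "\<lambda>i. if i < n then a i else c (i - n)"
    let ?b = "\<lambda>i. if i < n then b i else d (i - n)"
    have "(\<Sum>i<n + k. ?a i * ?b i) = (\<Sum>i<n. ?a i * ?b i) + (\<Sum>i<k. ?a (n + i) * ?b (n + i))"
      by (induction k) (simp_all add: add.assoc)
    also have "\<dots> = u + v"
      unfolding u v by simp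
    finally show ?thesis
      unfolding lat_mult_def using u v
      by (intro CollectI exI[of _ "n + k"] exI[of _ ?a] exI[of _ ?b]) auto
  qed
  have "lat_mult L1 L2 = int_module.span ?P"
  proof (rule subset_antisym; rule subsetI)
    fix x assume "x \<in> lat_mult L1 L2"
    then show "x \<in> int_module.span ?P"
      unfolding lat_mult_def using prod_in by (auto intro!: int_module.span_sum)
  next
    fix x assume "x \<in> int_module.span ?P"
    then show "x \<in> lat_mult L1 L2"
    proof (induction rule: int_module.span_induct_alt)
      case base
      show ?case unfolding lat_mult_def by (auto intro!: exI[of _ 0])
    next
      case (step c u v)
      obtain s t where st: "u = s * t" "s \<in> B1" "t \<in> B2"
        using step by auto
      have "scale (of_int c) s \<in> L1" "t \<in> L2"
        using st B int_module.span_base int_module.span_scale by auto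
      then show ?case
        using single add step st scale_mult_left by metis
    qed
  qed
  moreover have "x * y \<in> span (lat_mult L1 L2)" for x y
  proof -
    have "x \<in> span L1" "y \<in> span L2"
      by (simp_all add: sp)
    from \<open>x \<in> span L1\<close> show ?thesis
    proof (induction rule: span_induct_alt)
      case base
      show ?case by (simp add: span_zero)
    next
      case (step c u v)
      have "u * y \<in> span (lat_mult L1 L2)"
        using \<open>y \<in> span L2\<close>
      proof (induction rule: span_induct_alt)
        case base
        show ?case by (simp add: span_zero)
      next
        case (step d s t)
        have "u * s \<in> span (lat_mult L1 L2)"
          using step \<open>u \<in> L1\<close> single by (intro span_base) auto
        then show ?case
          using step span_scale[of "u * s" "lat_mult L1 L2" d]
          by (simp add: distrib_left scale_mult_right[symmetric] span_add)
      qed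
      then show ?case
        using step span_scale[of "u * y" "lat_mult L1 L2" c]
        by (simp add: distrib_right scale_mult_left[symmetric] span_add)
    qed
  qed
  then have "span (lat_mult L1 L2) = UNIV"
    by (metis UNIV_eq_I mult_1)
  moreover have "finite ?P"
    using B by simp
  ultimately show ?thesis
    unfolding full_lattices_def by blast
qed

lemma eps_mult_eps_class:
  assumes "L1 \<in> full_lattices scale" "L2 \<in> full_lattices scale"
  shows "eps_mult scale (eps_class scale L1) (eps_class scale L2) = eps_class scale (lat_mult L1 L2)"
proof -
  have *: "eps_class scale (lat_mult M1 M2) = eps_class scale (lat_mult L1 L2)"
    if M_class: "M1 \<in> eps_class scale L1" "M2 \<in> eps_class scale L2" for M1 M2
  proof -
    obtain a where a: "a dvd 1" "(*) a ` L1 = M1" "M1 \<in> full_lattices scale"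
      using M_class(1) unfolding eps_class_def eps_rel_def by auto
    obtain b where b: "b dvd 1" "(*) b ` L2 = M2" "M2 \<in> full_lattices scale"
      using M_class(2) unfolding eps_class_def eps_rel_def by auto
    obtain a' b' where ab: "1 = a * a'" "1 = b * b'"
      using a(1) b(1) by (auto elim!: dvdE)
    have "(a * b) * (a' * b') = (a * a') * (b * b')"
      by (simp only: mult_ac)
    then have "1 = (a * b) * (a' * b')"
      by (simp only: ab[symmetric] mult_1)
    then have "a * b dvd 1"
      by (rule dvdI)
    moreover have "(*) (a * b) ` lat_mult L1 L2 = lat_mult M1 M2"
      using lat_mult_scaled[of a L1 b L2] a(2) b(2) by simp
    ultimately have "(lat_mult L1 L2, lat_mult M1 M2) \<in> eps_rel scale"
      unfolding eps_rel_def using lat_mult_full_lattice assms a(3) b(3) by auto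
    then show ?thesis
      unfolding eps_class_def using equiv_class_eq[OF equiv_eps_rel] by metis
  qed
  have "L1 \<in> eps_class scale L1" "L2 \<in> eps_class scale L2"
    using assms equiv_class_self[OF equiv_eps_rel] unfolding eps_class_def by metis+
  then have ne: "eps_class scale L1 \<noteq> {}" "eps_class scale L2 \<noteq> {}"
    by auto
  show ?thesis
    unfolding eps_mult_def using ne by (simp add: * cong: SUP_cong_simp)
qed

end

end

theory Submission
  imports Defs
begin

text \<open>
  Write \<open>O(L)\<close> for the order of \<open>L\<close>. If \<open>L\<^sub>1 X\<^sub>1 = L\<^sub>2\<close> and \<open>L\<^sub>2 X\<^sub>2 = L\<^sub>1\<close>, then \<open>O(L\<^sub>1) \<subseteq> O(L\<^sub>1 X\<^sub>1) = O(L\<^sub>2)\<close>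
  and conversely, so both lattices have one order \<open>\<Lambda>\<close>. The candidate for the invertible lattice that carries
  \<open>L\<^sub>1\<close> to \<open>L\<^sub>2\<close> is \<open>L\<^sub>3 = X\<^sub>1 \<Lambda>\<close>, with inverse \<open>X\<^sub>2 \<Lambda>\<close>. The product \<open>M\<close> of these two satisfies
  \<open>L\<^sub>1 M = L\<^sub>1\<close>, hence \<open>M \<subseteq> \<Lambda>\<close>, and the whole point is that \<open>M\<close> is not smaller than \<open>\<Lambda>\<close>.
  This is Nakayama's lemma: \<open>L\<^sub>1 \<subseteq> L\<^sub>1 M\<close> with \<open>L\<^sub>1\<close> finitely generated yields \<open>m \<in> M\<close> with
  \<open>(1 - m) L\<^sub>1 = 0\<close>; as \<open>L\<^sub>1\<close> spans the algebra over the rationals, \<open>1 - m\<close> annihilates \<open>1\<close>, so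
  \<open>1 = m \<in> M\<close> and \<open>M = \<Lambda>\<close> (lemmas \<open>nakayama\<close>, \<open>one_in_if_absorbed\<close> and \<open>ex_sg_group_mult_eq\<close>).

  The lattice \<open>L\<^sub>3\<close> is unique because it can be recovered as \<open>L\<^sub>2 : L\<^sub>1\<close>: if \<open>a L\<^sub>1 \<subseteq> L\<^sub>2\<close> and \<open>L\<^sub>4\<close> is
  inverse to \<open>L\<^sub>3\<close>, then \<open>a L\<^sub>4 L\<^sub>1 \<subseteq> L\<^sub>2 L\<^sub>4 = L\<^sub>1\<close>, so \<open>a L\<^sub>4 \<subseteq> \<Lambda>\<close> and \<open>a \<in> a \<Lambda> = a L\<^sub>4 L\<^sub>3 \<subseteq> L\<^sub>3\<close>.

  Existence and uniqueness of \<open>L\<^sub>3\<close> are surjectivity and injectivity of \<open>L\<^sub>3 \<mapsto> L\<^sub>3 L\<^sub>1\<close>. That the group of an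
  idempotent is its \<open>w\<close>-class holds in every commutative semigroup. The statements about \<open>\<epsilon>\<close>-classes
  reduce to those about lattices since \<open>w\<close>-equivalence of classes is the same as \<open>w\<close>-equivalence of
  representatives: a unit relating representatives can be moved into the factor \<open>X\<^sub>i\<close>
  (lemma \<open>sg_w_equiv_eps_class_iff\<close>).
\<close>

section \<open>Groups and w-classes in commutative semigroups\<close>

locale comm_semigroup_on =
  fixes S :: "'s set" and m :: "'s \<Rightarrow> 's \<Rightarrow> 's"
  assumes closed: "x \<in> S \<Longrightarrow> y \<in> S \<Longrightarrow> m x y \<in> S"
    and assoc: "x \<in> S \<Longrightarrow> y \<in> S \<Longrightarrow> z \<in> S \<Longrightarrow> m (m x y) z = m x (m y z)"
    and comm: "x \<in> S \<Longrightarrow> y \<in> S \<Longrightarrow> m x y = m y x"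
begin

lemma sg_group_iff:
  "a \<in> sg_group S m c \<longleftrightarrow> a \<in> S \<and> c \<in> S \<and> (\<exists>b\<in>S. m a b = c \<and> m a c = a)"
proof
  assume "a \<in> sg_group S m c"
  then have inv: "sg_invertible S m a" and c: "sg_unit_of S m a = c"
    by (auto simp: sg_group_def)
  have "sg_unit_of S m a \<in> S \<and> (\<exists>b\<in>S. m a b = sg_unit_of S m a \<and> m a (sg_unit_of S m a) = a)"
    unfolding sg_unit_of_def by (rule theI'[OF sg_unit_of_unique[OF assoc comm inv]])
  then show "a \<in> S \<and> c \<in> S \<and> (\<exists>b\<in>S. m a b = c \<and> m a c = a)"
    using inv c by (simp add: sg_invertible_def)
next
  assume *: "a \<in> S \<and> c \<in> S \<and> (\<exists>b\<in>S. m a b = c \<and> m a c = a)"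
  then have inv: "sg_invertible S m a"
    by (auto simp: sg_invertible_def)
  then have "sg_unit_of S m a = c"
    unfolding sg_unit_of_def using * by (intro the1_equality sg_unit_of_unique[OF assoc comm]) auto
  with inv show "a \<in> sg_group S m c"
    by (simp add: sg_group_def)
qed

lemma sg_group_eq_sg_w_class:
  assumes c: "c \<in> S" "m c c = c"
  shows "sg_group S m c = sg_w_class S m c"
proof (intro set_eqI iffI)
  fix a assume "a \<in> sg_group S m c"
  then obtain b where "a \<in> S" "b \<in> S" "m a b = c" "m a c = a"
    by (auto simp: sg_group_iff)
  moreover from this have "m c a = a"
    using c comm by metis
  ultimately show "a \<in> sg_w_class S m c"
    using c by (auto simp: sg_w_class_def sg_w_equiv_def)
next
  fix a assume "a \<in> sg_w_class S m c"
  then have a: "a \<in> S" and "a = c \<or> (\<exists>x\<in>S. \<exists>y\<in>S. m c x = a \<and> m a y = c)"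
    by (auto simp: sg_w_class_def sg_w_equiv_def)
  then obtain x y where xy: "x \<in> S" "y \<in> S" "m c x = a" "m a y = c"
    using c by metis
  have "m a c = m c (m c x)"
    using a c xy comm by metis
  also have "\<dots> = a"
    using c xy assoc by metis
  finally show "a \<in> sg_group S m c"
    unfolding sg_group_iff using a c xy by blast
qed

end

section \<open>Submodules of finitely generated modules over the integers\<close>

lemma int_ideal_principal:
  fixes I :: "int set"
  assumes zero: "0 \<in> I"
    and diff: "\<And>x y. x \<in> I \<Longrightarrow> y \<in> I \<Longrightarrow> x - y \<in> I"
    and mult: "\<And>c x. x \<in> I \<Longrightarrow> c * x \<in> I"
  obtains d where "d \<in> I" "\<And>k. k \<in> I \<Longrightarrow> d dvd k"
proof (cases "I = {0}")
  case True
  then show ?thesis using that by auto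
next
  case False
  with zero obtain k where "k \<in> I \<and> k \<noteq> 0" by auto
  from ex_has_least_nat[of "\<lambda>k. k \<in> I \<and> k \<noteq> 0", OF this, of "\<lambda>k. nat \<bar>k\<bar>"]
  obtain d where d: "d \<in> I" "d \<noteq> 0"
    and least: "\<And>k. k \<in> I \<Longrightarrow> k \<noteq> 0 \<Longrightarrow> nat \<bar>d\<bar> \<le> nat \<bar>k\<bar>"
    by blast
  have "d dvd k" if k: "k \<in> I" for k
  proof -
    have "k mod d = k - (k div d) * d"
      by (simp add: minus_div_mult_eq_mod)
    then have "k mod d \<in> I"
      using k d diff mult by simp
    moreover have "\<not> nat \<bar>d\<bar> \<le> nat \<bar>k mod d\<bar>"
      using abs_mod_less[OF d(2), of k] by linarith
    ultimately show ?thesis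
      using least by (auto simp: dvd_eq_mod_eq_0)
  qed
  then show ?thesis using d that by blast
qed

text \<open>
  The coefficients at one generator \<open>b\<close> of the elements of \<open>N\<close> form an ideal of the integers.
  An element \<open>x\<^sub>0\<close> of \<open>N\<close> whose coefficient generates that ideal, and generators of the part of \<open>N\<close>
  spanned by the other generators, together generate \<open>N\<close>.
\<close>

lemma int_submodule_finitely_generated:
  fixes scale :: "int \<Rightarrow> 'b::ab_group_add \<Rightarrow> 'b"
  assumes mod: "module scale" and "finite B"
    and "module.subspace scale N" "N \<subseteq> module.span scale B"
  shows "\<exists>C. finite C \<and> N = module.span scale C"
proof -
  interpret module scale by (rule mod)
  show ?thesis
    using assms(2-)
  proof (induction B arbitrary: N rule: finite_induct)
    case empty
    then have "N = span {}"
      using subspace_0 by auto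
    then show ?case by blast
  next
    case (insert b B)
    define I where "I = {k. \<exists>x\<in>N. x - scale k b \<in> span B}"
    have "0 \<in> I"
      using subspace_0[OF insert.prems(1)] by (auto simp: I_def span_zero intro!: bexI[of _ 0])
    moreover have "k - l \<in> I" if kl: "k \<in> I" "l \<in> I" for k l
    proof -
      obtain x y where xy: "x \<in> N" "x - scale k b \<in> span B" "y \<in> N" "y - scale l b \<in> span B"
        using kl unfolding I_def by blast
      have eq: "(x - y) - scale (k - l) b = (x - scale k b) - (y - scale l b)"
        by (simp add: scale_left_diff_distrib)
      have "(x - y) - scale (k - l) b \<in> span B"
        unfolding eq by (rule span_diff[OF xy(2,4)])
      then show ?thesis
        unfolding I_def using xy subspace_diff[OF insert.prems(1)] by blast
    qed
    moreover have "c * k \<in> I" if k: "k \<in> I" for c k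
    proof -
      obtain x where x: "x \<in> N" "x - scale k b \<in> span B"
        using k by (auto simp: I_def)
      have eq: "scale c x - scale (c * k) b = scale c (x - scale k b)"
        by (simp add: scale_right_diff_distrib)
      have "scale c x - scale (c * k) b \<in> span B"
        unfolding eq using x by (intro span_scale)
      then show ?thesis
        unfolding I_def using x subspace_scale[OF insert.prems(1)] by blast
    qed
    ultimately obtain d where "d \<in> I" and d_dvd: "\<And>k. k \<in> I \<Longrightarrow> d dvd k"
      using int_ideal_principal by metis
    then obtain x0 where x0: "x0 \<in> N" "x0 - scale d b \<in> span B"
      by (auto simp: I_def)
    obtain C where C: "finite C" "N \<inter> span B = span C"
      using insert.IH[of "N \<inter> span B"] subspace_inter[OF insert.prems(1) subspace_span] by auto
    have "N = span (insert x0 C)"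
    proof (rule subset_antisym; rule subsetI)
      fix x assume x: "x \<in> N"
      then obtain k where k: "x - scale k b \<in> span B"
        using insert.prems(2) span_breakdown_eq by blast
      with x have "k \<in> I" by (auto simp: I_def)
      then obtain c where c: "k = d * c"
        using d_dvd by (auto elim: dvdE)
      have eq: "x - scale c x0 = (x - scale k b) - scale c (x0 - scale d b)"
        by (simp add: c scale_right_diff_distrib mult.commute)
      have "x - scale c x0 \<in> span B"
        unfolding eq by (rule span_diff[OF k span_scale[OF x0(2)]])
      moreover have "x - scale c x0 \<in> N"
        using x x0 insert.prems(1) by (simp add: subspace_diff subspace_scale)
      ultimately show "x \<in> span (insert x0 C)"
        using C span_breakdown_eq by blast
    next
      have "insert x0 C \<subseteq> N"
        using x0 C span_superset by blast
      then show "x \<in> N" if "x \<in> span (insert x0 C)" for x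
        using that span_minimal[OF _ insert.prems(1)] by blast
    qed
    then show ?case using C(1) by blast
  qed
qed

section \<open>Nakayama's lemma\<close>

text \<open>
  The generators are eliminated one at a time. If \<open>(1 - m) b = f b + \<dots>\<close> is the expansion of a
  generator \<open>b\<close> with \<open>f \<in> M\<close>, then \<open>(1 - m - f) b\<close> involves only the other generators, so that
  multiplication of all of \<open>L\<close> by \<open>(1 - m - f) (1 - m)\<close>, which again has the form \<open>1 - m'\<close> with
  \<open>m' \<in> M\<close>, leads to combinations of the other generators.
\<close>

lemma nakayama:
  fixes M L B :: "'a::{comm_ring, comm_monoid_mult} set"
  assumes diff: "\<And>x y. x \<in> M \<Longrightarrow> y \<in> M \<Longrightarrow> x - y \<in> M"
    and mult: "\<And>x y. x \<in> M \<Longrightarrow> y \<in> M \<Longrightarrow> x * y \<in> M"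
    and "finite B" "B \<subseteq> L" "m \<in> M"
    and "\<And>x. x \<in> L \<Longrightarrow> \<exists>f. (\<forall>b\<in>B. f b \<in> M) \<and> (1 - m) * x = (\<Sum>b\<in>B. f b * b)"
  shows "\<exists>m\<in>M. \<forall>x\<in>L. (1 - m) * x = 0"
  using assms(3-)
proof (induction B arbitrary: m rule: finite_induct)
  case empty
  then show ?case by auto
next
  case (insert b B)
  have add: "x + y \<in> M" if "x \<in> M" "y \<in> M" for x y
    using diff[of x "y - y - y"] diff[of y y] diff[of "y - y" y] that by simp
  obtain g where g: "\<forall>c\<in>insert b B. g c \<in> M"
    "(1 - m) * b = (\<Sum>c\<in>insert b B. g c * c)"
    using insert.prems(3)[of b] insert.prems(1) by auto
  define m1 where "m1 = m + g b"
  define m2 where "m2 = m + m1 - m1 * m"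
  have m1: "m1 \<in> M" and m2: "m2 \<in> M"
    using g insert.prems(2) add diff mult by (simp_all add: m1_def m2_def)
  have b: "(1 - m1) * b = (\<Sum>c\<in>B. g c * c)"
    using g(2) insert.hyps by (simp add: m1_def algebra_simps)
  have "\<exists>f. (\<forall>c\<in>B. f c \<in> M) \<and> (1 - m2) * x = (\<Sum>c\<in>B. f c * c)" if x: "x \<in> L" for x
  proof -
    obtain f where f: "\<forall>c\<in>insert b B. f c \<in> M" "(1 - m) * x = (\<Sum>c\<in>insert b B. f c * c)"
      using insert.prems(3)[OF x] by auto
    have "(1 - m2) * x = (1 - m1) * ((1 - m) * x)"
      by (simp add: m2_def algebra_simps)
    also have "\<dots> = f b * ((1 - m1) * b) + (1 - m1) * (\<Sum>c\<in>B. f c * c)"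
      unfolding f(2) using insert.hyps by (simp add: distrib_left mult_ac)
    also have "\<dots> = (\<Sum>c\<in>B. (f b * g c + (f c - m1 * f c)) * c)"
      unfolding b sum_distrib_left sum.distrib[symmetric]
      by (intro sum.cong refl) (simp add: algebra_simps)
    finally show ?thesis
      using f(1) g(1) m1 add diff mult
      by (intro exI[of _ "\<lambda>c. f b * g c + (f c - m1 * f c)"]) simp
  qed
  then show ?case
    using insert.IH[OF _ m2] insert.prems(1) by blast
qed

section \<open>Multiplication of subsets\<close>

definition add_closed :: "'a::comm_monoid_add set \<Rightarrow> bool" where
  "add_closed C \<longleftrightarrow> 0 \<in> C \<and> (\<forall>x\<in>C. \<forall>y\<in>C. x + y \<in> C)"

lemma lat_mult_least:
  assumes "add_closed C" and prod: "\<And>x y. x \<in> L1 \<Longrightarrow> y \<in> L2 \<Longrightarrow> x * y \<in> C"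
  shows "lat_mult L1 L2 \<subseteq> C"
proof
  fix z assume "z \<in> lat_mult L1 L2"
  then obtain n :: nat and a b where ab: "\<forall>i<n. a i \<in> L1 \<and> b i \<in> L2"
    and z: "z = (\<Sum>i<n. a i * b i)"
    unfolding lat_mult_def by blast
  have "(\<Sum>i<k. a i * b i) \<in> C" if "k \<le> n" for k
    using that
  proof (induction k)
    case (Suc k)
    then show ?case using assms ab by (simp add: add_closed_def)
  qed (use assms in \<open>simp add: add_closed_def\<close>)
  then show "z \<in> C" unfolding z by simp
qed

lemma mult_in_lat_mult: "x \<in> L1 \<Longrightarrow> y \<in> L2 \<Longrightarrow> x * y \<in> lat_mult L1 L2"
  unfolding lat_mult_def
  by (intro CollectI exI[of _ "Suc 0"] exI[of _ "\<lambda>_. x"] exI[of _ "\<lambda>_. y"]) auto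

lemma add_closed_lat_mult: "add_closed (lat_mult L1 L2)"
  unfolding add_closed_def
proof (intro conjI ballI)
  show "0 \<in> lat_mult L1 L2"
    unfolding lat_mult_def by (auto intro!: exI[of _ 0])
next
  fix u v assume uv: "u \<in> lat_mult L1 L2" "v \<in> lat_mult L1 L2"
  obtain n k :: nat and a b c d where
    u: "\<forall>i<n. a i \<in> L1 \<and> b i \<in> L2" "u = (\<Sum>i<n. a i * b i)" and
    v: "\<forall>i<k. c i \<in> L1 \<and> d i \<in> L2" "v = (\<Sum>i<k. c i * d i)"
    using uv unfolding lat_mult_def by blast
  let ?a = "\<lambda>i. if i < n then a i else c (i - n)"
  let ?b = "\<lambda>i. if i < n then b i else d (i - n)"
  have "(\<Sum>i<n + k. ?a i * ?b i) = (\<Sum>i<n. ?a i * ?b i) + (\<Sum>i<k. ?a (n + i) * ?b (n + i))"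
    by (induction k) (simp_all add: add.assoc)
  also have "\<dots> = u + v"
    unfolding u v by simp
  finally show "u + v \<in> lat_mult L1 L2"
    unfolding lat_mult_def using u v
    by (intro CollectI exI[of _ "n + k"] exI[of _ ?a] exI[of _ ?b]) auto
qed

lemma lat_mult_mono: "L1 \<subseteq> L1' \<Longrightarrow> L2 \<subseteq> L2' \<Longrightarrow> lat_mult L1 L2 \<subseteq> lat_mult L1' L2'"
  by (intro lat_mult_least add_closed_lat_mult) (auto intro: mult_in_lat_mult)

lemma lat_mult_commute: "lat_mult L1 L2 = lat_mult L2 L1"
proof -
  have "lat_mult K L \<subseteq> lat_mult L K" for K L :: "'a set"
    by (intro lat_mult_least add_closed_lat_mult) (metis mult.commute mult_in_lat_mult)
  then show ?thesis by blast
qed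

lemma lat_mult_assoc: "lat_mult (lat_mult L1 L2) L3 = lat_mult L1 (lat_mult L2 L3)"
proof -
  have sub: "lat_mult J (lat_mult K L) \<subseteq> lat_mult (lat_mult J K) L" for J K L :: "'a set"
  proof (intro lat_mult_least add_closed_lat_mult)
    fix x y assume x: "x \<in> J" and y: "y \<in> lat_mult K L"
    have "lat_mult K L \<subseteq> {y. x * y \<in> lat_mult (lat_mult J K) L}"
    proof (rule lat_mult_least)
      show "add_closed {y. x * y \<in> lat_mult (lat_mult J K) L}"
        using add_closed_lat_mult[of "lat_mult J K" L] by (simp add: add_closed_def distrib_left)
      show "u * v \<in> {y. x * y \<in> lat_mult (lat_mult J K) L}" if "u \<in> K" "v \<in> L" for u v
        using mult_in_lat_mult[OF mult_in_lat_mult[OF x that(1)] that(2)] by (simp add: mult.assoc)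
    qed
    then show "x * y \<in> lat_mult (lat_mult J K) L" using y by auto
  qed
  have "lat_mult (lat_mult L1 L2) L3 = lat_mult L3 (lat_mult L2 L1)"
    by (simp only: lat_mult_commute)
  also have "\<dots> \<subseteq> lat_mult (lat_mult L3 L2) L1"
    by (rule sub)
  also have "\<dots> = lat_mult L1 (lat_mult L2 L3)"
    by (simp only: lat_mult_commute)
  finally show ?thesis using sub by blast
qed

lemma lat_mult_image_left: "lat_mult ((*) a ` L1) L2 = (*) a ` lat_mult L1 L2"
  using lat_mult_scaled[of a L1 1 L2] by simp

lemma one_in_lat_order: "1 \<in> lat_order L"
  by (simp add: lat_order_def lat_quot_def)

lemma lat_order_mult_in: "a \<in> lat_order L \<Longrightarrow> x \<in> L \<Longrightarrow> a * x \<in> L"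
  by (auto simp: lat_order_def lat_quot_def)

lemma lat_mult_lat_order: "add_closed L \<Longrightarrow> lat_mult L (lat_order L) = L"
proof (rule subset_antisym)
  assume "add_closed L"
  then show "lat_mult L (lat_order L) \<subseteq> L"
    by (rule lat_mult_least) (metis lat_order_mult_in mult.commute)
  show "L \<subseteq> lat_mult L (lat_order L)"
    using mult_in_lat_mult[OF _ one_in_lat_order] by fastforce
qed

lemma add_closed_lat_order: "add_closed L \<Longrightarrow> add_closed (lat_order L)"
  by (simp add: add_closed_def lat_order_def lat_quot_def image_subset_iff distrib_right)

lemma lat_order_idem: "add_closed L \<Longrightarrow> lat_mult (lat_order L) (lat_order L) = lat_order L"
proof (rule subset_antisym)
  assume "add_closed L"
  then show "lat_mult (lat_order L) (lat_order L) \<subseteq> lat_order L"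
    by (intro lat_mult_least add_closed_lat_order)
      (auto simp: lat_order_def lat_quot_def mult.assoc)
  show "lat_order L \<subseteq> lat_mult (lat_order L) (lat_order L)"
    using mult_in_lat_mult[OF _ one_in_lat_order] by fastforce
qed

lemma lat_order_mono_mult: "lat_order L \<subseteq> lat_order (lat_mult L X)"
proof
  fix a assume "a \<in> lat_order L"
  then have "lat_mult ((*) a ` L) X \<subseteq> lat_mult L X"
    by (intro lat_mult_mono) (auto simp: lat_order_def lat_quot_def)
  then show "a \<in> lat_order (lat_mult L X)"
    by (simp add: lat_order_def lat_quot_def lat_mult_image_left)
qed

section \<open>Full lattices\<close>

context fin_dim_comm_rat_algebra
begin

lemma full_lattice_subspace: "L \<in> full_lattices scale \<Longrightarrow> int_module.subspace L"
  by (auto simp: full_lattices_def)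

lemma full_lattice_add_closed: "L \<in> full_lattices scale \<Longrightarrow> add_closed L"
  using full_lattice_subspace by (auto simp: add_closed_def int_module.subspace_def)

sublocale lat: comm_semigroup_on "full_lattices scale" lat_mult
  by (unfold_locales, rule lat_mult_full_lattice, assumption+, rule lat_mult_assoc, rule lat_mult_commute)

lemma common_denominator:
  assumes L: "int_module.subspace L" and "finite F" "F \<subseteq> span L"
  shows "\<exists>N::int. N \<noteq> 0 \<and> (\<forall>x\<in>F. scale (of_int N) x \<in> L)"
  using assms(2-)
proof (induction F rule: finite_induct)
  case empty
  show ?case by (auto intro: exI[of _ 1])
next
  case (insert x F)
  have "x \<in> span L" using insert by simp
  then have "\<exists>N::int. N \<noteq> 0 \<and> scale (of_int N) x \<in> L"
  proof (induction rule: span_induct_alt)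
    case base
    show ?case using int_module.subspace_0[OF L] by (auto intro: exI[of _ 1])
  next
    case (step c u v)
    obtain N :: int where N: "N \<noteq> 0" "scale (of_int N) v \<in> L"
      using step by blast
    obtain p q :: int where pq: "c = of_int p / of_int q" "q \<noteq> 0"
      by (metis Fract_of_int_quotient Rat_cases less_irrefl)
    have "scale (of_int (q * N)) (scale c u + v)
        = scale (of_int (p * N)) u + scale (of_int q) (scale (of_int N) v)"
      using pq by (simp add: scale_right_distrib mult_ac)
    also have "\<dots> \<in> L"
      using L step N int_module.subspace_add int_module.subspace_scale by blast
    finally show ?case using N pq by (intro exI[of _ "q * N"]) simp
  qed
  then obtain N :: int where N: "N \<noteq> 0" "scale (of_int N) x \<in> L" by blast
  obtain K :: int where K: "K \<noteq> 0" "\<forall>x\<in>F. scale (of_int K) x \<in> L"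
    using insert by auto
  have "scale (of_int (K * N)) y \<in> L" if "y \<in> insert x F" for y
  proof (cases "y = x")
    case True
    have eq: "scale (of_int (K * N)) y = scale (of_int K) (scale (of_int N) x)"
      using True by (simp only: scale_scale of_int_mult)
    show ?thesis unfolding eq by (rule int_module.subspace_scale[OF L N(2)])
  next
    case False
    have eq: "scale (of_int (K * N)) y = scale (of_int N) (scale (of_int K) y)"
      by (simp add: mult.commute)
    show ?thesis unfolding eq using False that K int_module.subspace_scale[OF L] by blast
  qed
  then show ?case using N K by (intro exI[of _ "K * N"]) simp
qed

text \<open>
  With a common denominator \<open>N\<close> of \<open>1\<close> with respect to \<open>L\<close>, the order is contained in the finitely
  generated module \<open>N\<^sup>-\<^sup>1 L\<close>. It spans the algebra because any element times a common denominator of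
  its products with the generators of \<open>L\<close> lies in the order.
\<close>

lemma lat_order_full_lattice:
  assumes "L \<in> full_lattices scale"
  shows "lat_order L \<in> full_lattices scale"
proof -
  obtain B where B: "finite B" "L = int_module.span B" and sp: "span L = UNIV"
    using assms unfolding full_lattices_def by blast
  have L: "int_module.subspace L"
    by (rule full_lattice_subspace[OF assms])
  obtain N :: int where N: "N \<noteq> 0" "scale (of_int N) 1 \<in> L"
    using common_denominator[OF L, of "{1}"] sp by auto
  let ?B' = "scale (1 / of_int N) ` B"
  have "lat_order L \<subseteq> int_module.span ?B'"
  proof
    fix a assume "a \<in> lat_order L"
    from lat_order_mult_in[OF this N(2)] have "scale (of_int N) a \<in> int_module.span B"
      unfolding B by (simp add: scale_mult_right[symmetric])
    then have "scale (1 / of_int N) (scale (of_int N) a) \<in> int_module.span ?B'"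
    proof (induction rule: int_module.span_induct_alt)
      case base
      show ?case by (simp add: int_module.span_zero)
    next
      case (step c x y)
      have "scale (of_int c) (scale (1 / of_int N) x) \<in> int_module.span ?B'"
        using step by (intro int_module.span_scale int_module.span_base) auto
      then show ?case
        using step int_module.span_add by (simp add: scale_right_distrib mult.commute)
    qed
    then show "a \<in> int_module.span ?B'"
      using N by simp
  qed
  moreover have "int_module.subspace (lat_order L)"
  proof (rule int_module.subspaceI)
    show "x + y \<in> lat_order L" if "x \<in> lat_order L" "y \<in> lat_order L" for x y
      using add_closed_lat_order[OF full_lattice_add_closed[OF assms]] that
      by (auto simp: add_closed_def)
    show "scale (of_int c) x \<in> lat_order L" if "x \<in> lat_order L" for c x
      using that int_module.subspace_scale[OF L]
      by (auto simp: lat_order_def lat_quot_def scale_mult_left[symmetric])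
  qed (use add_closed_lat_order[OF full_lattice_add_closed[OF assms]] in \<open>auto simp: add_closed_def\<close>)
  ultimately have "\<exists>C. finite C \<and> lat_order L = int_module.span C"
    using B(1) by (intro int_submodule_finitely_generated[OF int_module.module_axioms]) auto
  moreover have "a \<in> span (lat_order L)" for a
  proof -
    obtain K :: int where K: "K \<noteq> 0" "\<forall>x\<in>(*) a ` B. scale (of_int K) x \<in> L"
      using common_denominator[OF L, of "(*) a ` B"] B sp by auto
    have "scale (of_int K) a * x \<in> L" if "x \<in> L" for x
      using that unfolding B(2)
    proof (induction rule: int_module.span_induct_alt)
      case base
      show ?case by (simp add: int_module.span_zero)
    next
      case (step c x y)
      have "scale (of_int K) a * x \<in> L"
        using K step by (simp add: scale_mult_left[symmetric])
      then show ?case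
        using step int_module.span_scale[of "scale (of_int K) a * x" B c] B
        by (simp add: distrib_left scale_mult_right[symmetric] int_module.span_add)
    qed
    then have "scale (of_int K) a \<in> lat_order L"
      by (auto simp: lat_order_def lat_quot_def)
    then have "scale (1 / of_int K) (scale (of_int K) a) \<in> span (lat_order L)"
      by (intro span_scale span_base)
    then show ?thesis using K by simp
  qed
  ultimately show ?thesis
    unfolding full_lattices_def by blast
qed

text \<open>
  Integer coefficients of elements of \<open>L\<close> can be moved into \<open>M\<close>, so \<open>L M = L\<close> turns generators of \<open>L\<close> over
  the integers into generators with coefficients in \<open>M\<close>. Nakayama's lemma then provides \<open>m \<in> M\<close> with
  \<open>(1 - m) L = 0\<close>, and \<open>1 - m\<close> annihilates the rational span of \<open>L\<close> too, which contains \<open>1\<close>.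
\<close>

lemma one_in_if_absorbed:
  assumes L: "L \<in> full_lattices scale" and M: "M \<in> full_lattices scale"
    and MM: "lat_mult M M \<subseteq> M" and LM: "lat_mult L M = L"
  shows "1 \<in> M"
proof -
  obtain B where B: "finite B" "L = int_module.span B" and sp: "span L = UNIV"
    using L unfolding full_lattices_def by blast
  have subM: "int_module.subspace M"
    by (rule full_lattice_subspace[OF M])
  let ?T = "{x. \<exists>f. (\<forall>b\<in>B. f b \<in> M) \<and> x = (\<Sum>b\<in>B. f b * b)}"
  have "lat_mult L M \<subseteq> ?T"
  proof (rule lat_mult_least)
    have "0 \<in> ?T"
      using int_module.subspace_0[OF subM] by (auto intro!: exI[of _ "\<lambda>_. 0"])
    moreover have "x + y \<in> ?T" if xy: "x \<in> ?T" "y \<in> ?T" for x y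
    proof -
      obtain f g where "\<forall>b\<in>B. f b \<in> M" "x = (\<Sum>b\<in>B. f b * b)"
        "\<forall>b\<in>B. g b \<in> M" "y = (\<Sum>b\<in>B. g b * b)"
        using xy by blast
      then show ?thesis
        using int_module.subspace_add[OF subM]
        by (intro CollectI exI[of _ "\<lambda>b. f b + g b"]) (simp add: distrib_right sum.distrib)
    qed
    ultimately show "add_closed ?T"
      unfolding add_closed_def by blast
    fix y m assume y: "y \<in> L" and m: "m \<in> M"
    obtain u where "y = (\<Sum>b\<in>B. scale (of_int (u b)) b)"
      using y unfolding B(2) int_module.span_finite[OF B(1)] by blast
    then have "y * m = (\<Sum>b\<in>B. scale (of_int (u b)) b * m)"
      by (simp add: sum_distrib_right)
    also have "\<dots> = (\<Sum>b\<in>B. scale (of_int (u b)) m * b)"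
      by (intro sum.cong refl) (metis scale_mult_left mult.commute)
    finally have "y * m = (\<Sum>b\<in>B. scale (of_int (u b)) m * b)" .
    then show "y * m \<in> ?T"
      using int_module.subspace_scale[OF subM m]
      by (intro CollectI exI[of _ "\<lambda>b. scale (of_int (u b)) m"]) simp
  qed
  then have "\<exists>m\<in>M. \<forall>x\<in>L. (1 - m) * x = 0"
    unfolding LM
    using subsetD[OF MM mult_in_lat_mult] int_module.span_superset[of B] B
      int_module.subspace_diff[OF subM] int_module.subspace_0[OF subM]
    by (intro nakayama[where m = 0 and B = B]) auto
  then obtain m where m: "m \<in> M" "\<And>x. x \<in> L \<Longrightarrow> (1 - m) * x = 0"
    by blast
  have "(1 - m) * x = 0" if "x \<in> span L" for x
    using that
    by (induction rule: span_induct_alt)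
      (simp_all add: m distrib_left scale_mult_right[symmetric])
  from this[of 1] show ?thesis using m(1) by (simp add: sp)
qed

section \<open>w-equivalence of full lattices\<close>

text \<open>
  The case \<open>L\<^sub>1 = L\<^sub>2\<close> of the definition is covered by multiplication with the order, which is
  itself a full lattice.
\<close>

lemma sg_w_equiv_lat_iff:
  "sg_w_equiv (full_lattices scale) lat_mult L1 L2 \<longleftrightarrow>
     L1 \<in> full_lattices scale \<and> L2 \<in> full_lattices scale \<and>
     (\<exists>X1\<in>full_lattices scale. \<exists>X2\<in>full_lattices scale. lat_mult L1 X1 = L2 \<and> lat_mult L2 X2 = L1)"
proof -
  have "\<exists>X\<in>full_lattices scale. lat_mult L X = L" if "L \<in> full_lattices scale" for L
    using that lat_order_full_lattice full_lattice_add_closed lat_mult_lat_order by blast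
  then show ?thesis
    unfolding sg_w_equiv_def by blast
qed

lemma lat_order_eq_if_w_equiv:
  "sg_w_equiv (full_lattices scale) lat_mult L1 L2 \<Longrightarrow> lat_order L1 = lat_order L2"
  unfolding sg_w_equiv_lat_iff using lat_order_mono_mult by (metis subset_antisym)

text \<open>
  The given factors \<open>X\<^sub>1\<close> and \<open>X\<^sub>2\<close> need not be modules over the common order \<open>\<Lambda>\<close>; multiplying them by \<open>\<Lambda>\<close>
  makes them so without changing their products with \<open>L\<^sub>1\<close> and \<open>L\<^sub>2\<close>. For the product \<open>M\<close> of the results this
  gives \<open>M M \<subseteq> M \<Lambda> = M\<close> once \<open>M \<subseteq> \<Lambda>\<close> is known, and \<open>1 \<in> M\<close> suffices for \<open>M = \<Lambda>\<close>.
\<close>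

lemma ex_sg_group_mult_eq:
  assumes w: "sg_w_equiv (full_lattices scale) lat_mult L1 L2"
  shows "\<exists>L3\<in>sg_group (full_lattices scale) lat_mult (lat_order L1). lat_mult L1 L3 = L2"
proof -
  obtain X1 X2 where L: "L1 \<in> full_lattices scale" "L2 \<in> full_lattices scale"
    and X: "X1 \<in> full_lattices scale" "X2 \<in> full_lattices scale"
    and eq: "lat_mult L1 X1 = L2" "lat_mult L2 X2 = L1"
    using w unfolding sg_w_equiv_lat_iff by blast
  define \<Lambda> where "\<Lambda> = lat_order L1"
  have \<Lambda>: "\<Lambda> \<in> full_lattices scale" "lat_mult \<Lambda> \<Lambda> = \<Lambda>" "lat_mult L1 \<Lambda> = L1" "lat_mult L2 \<Lambda> = L2"
    using L lat_order_eq_if_w_equiv[OF w] lat_mult_lat_order[of L1] lat_mult_lat_order[of L2]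
    by (simp_all add: \<Lambda>_def lat_order_full_lattice lat_order_idem full_lattice_add_closed
        lat_mult_lat_order)
  define L3 where "L3 = lat_mult X1 \<Lambda>"
  define L4 where "L4 = lat_mult X2 \<Lambda>"
  define M where "M = lat_mult L3 L4"
  have full: "L3 \<in> full_lattices scale" "L4 \<in> full_lattices scale" "M \<in> full_lattices scale"
    using X \<Lambda>(1) by (simp_all add: L3_def L4_def M_def lat_mult_full_lattice)
  have absorb: "lat_mult L3 \<Lambda> = L3" "lat_mult L4 \<Lambda> = L4" "lat_mult M \<Lambda> = M"
    by (simp_all add: L3_def L4_def M_def lat_mult_assoc \<Lambda>)
  have L13: "lat_mult L1 L3 = L2" and L24: "lat_mult L2 L4 = L1"
    unfolding L3_def L4_def lat_mult_assoc[symmetric] eq \<Lambda> by (rule refl)+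
  then have L1M: "lat_mult L1 M = L1"
    by (simp add: M_def lat_mult_assoc[symmetric])
  have M_sub: "M \<subseteq> \<Lambda>"
  proof
    fix x assume x: "x \<in> M"
    then have "x * y \<in> L1" if "y \<in> L1" for y
      using mult_in_lat_mult[OF that x] L1M by (simp add: mult.commute)
    then show "x \<in> \<Lambda>"
      by (auto simp: \<Lambda>_def lat_order_def lat_quot_def)
  qed
  then have "lat_mult M M \<subseteq> M"
    using lat_mult_mono[of M M M \<Lambda>] absorb by simp
  then have "1 \<in> M"
    using one_in_if_absorbed L full L1M by blast
  then have "\<Lambda> \<subseteq> lat_mult M \<Lambda>"
    using mult_in_lat_mult[of 1 M] by fastforce
  with M_sub absorb have "lat_mult L3 L4 = \<Lambda>"
    by (simp add: M_def)
  then have "L3 \<in> sg_group (full_lattices scale) lat_mult \<Lambda>"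
    unfolding lat.sg_group_iff using full \<Lambda> absorb by blast
  then show ?thesis
    using L13 by (auto simp: \<Lambda>_def)
qed

text \<open>
  An inverse \<open>L\<^sub>4\<close> of \<open>L\<^sub>3\<close> cancels \<open>L\<^sub>3\<close>: from \<open>a L\<^sub>1 \<subseteq> L\<^sub>1 L\<^sub>3\<close> follows \<open>a L\<^sub>4 L\<^sub>1 \<subseteq> L\<^sub>1\<close>, that is
  \<open>a L\<^sub>4 \<subseteq> O(L\<^sub>1)\<close>, and multiplication by \<open>L\<^sub>3\<close> leads to \<open>a O(L\<^sub>1) \<subseteq> L\<^sub>3\<close>.
\<close>

lemma sg_group_eq_lat_quot:
  assumes L1: "L1 \<in> full_lattices scale"
    and L3: "L3 \<in> sg_group (full_lattices scale) lat_mult (lat_order L1)"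
  shows "L3 = lat_quot (lat_mult L1 L3) L1"
proof (rule subset_antisym; rule subsetI)
  fix x assume "x \<in> L3"
  then show "x \<in> lat_quot (lat_mult L1 L3) L1"
    using mult_in_lat_mult[of _ L1 x L3] by (auto simp: lat_quot_def mult.commute)
next
  fix a assume "a \<in> lat_quot (lat_mult L1 L3) L1"
  then have a: "(*) a ` L1 \<subseteq> lat_mult L1 L3"
    by (simp add: lat_quot_def)
  obtain L4 where L4: "lat_mult L3 L4 = lat_order L1" "lat_mult L3 (lat_order L1) = L3"
    using L3 by (auto simp: lat.sg_group_iff)
  have "a * y \<in> lat_order L1" if y: "y \<in> L4" for y
  proof -
    have "a * y * x \<in> L1" if x: "x \<in> L1" for x
    proof -
      have "(a * x) * y \<in> lat_mult (lat_mult L1 L3) L4"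
        by (rule mult_in_lat_mult[OF subsetD[OF a imageI[OF x]] y])
      also have "\<dots> = L1"
        by (simp add: lat_mult_assoc L4 lat_mult_lat_order full_lattice_add_closed L1)
      finally show ?thesis by (simp add: mult_ac)
    qed
    then show ?thesis by (auto simp: lat_order_def lat_quot_def)
  qed
  then have "lat_mult ((*) a ` L4) L3 \<subseteq> lat_mult (lat_order L1) L3"
    by (intro lat_mult_mono) auto
  then have "(*) a ` lat_order L1 \<subseteq> L3"
    unfolding lat_mult_image_left unfolding lat_mult_commute[of _ L3] L4 .
  then show "a \<in> L3"
    using one_in_lat_order[of L1] by auto
qed

text \<open>Multiplying \<open>L\<^sub>1 L\<close> by an inverse of \<open>L\<close> gives \<open>L\<^sub>1 O(L\<^sub>1) = L\<^sub>1\<close> back.\<close>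

lemma sg_w_equiv_mult_sg_group:
  assumes L1: "L1 \<in> full_lattices scale"
    and L: "L \<in> sg_group (full_lattices scale) lat_mult (lat_order L1)"
  shows "sg_w_equiv (full_lattices scale) lat_mult L1 (lat_mult L1 L)"
proof -
  obtain L' where L': "L \<in> full_lattices scale" "L' \<in> full_lattices scale"
    "lat_mult L L' = lat_order L1"
    using L by (auto simp: lat.sg_group_iff)
  then have "lat_mult (lat_mult L1 L) L' = L1"
    by (simp add: lat_mult_assoc lat_mult_lat_order full_lattice_add_closed L1)
  then show ?thesis
    unfolding sg_w_equiv_lat_iff using L1 L' lat_mult_full_lattice by blast
qed

section \<open>Classes modulo units\<close>

lemma eps_class_eq_iff:
  assumes "L \<in> full_lattices scale" "L' \<in> full_lattices scale"
  shows "eps_class scale L = eps_class scale L' \<longleftrightarrow> (\<exists>a. a dvd 1 \<and> (*) a ` L = L')"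
  unfolding eps_class_def eq_equiv_class_iff[OF equiv_eps_rel assms]
  using assms by (simp add: eps_rel_def)

lemma eps_classes_eq: "eps_classes scale = eps_class scale ` full_lattices scale"
  by (auto simp: eps_classes_def eps_class_def quotient_def)

sublocale eps: comm_semigroup_on "eps_classes scale" "eps_mult scale"
proof
  fix X Y assume XY: "X \<in> eps_classes scale" "Y \<in> eps_classes scale"
  then obtain L1 L2 where L: "L1 \<in> full_lattices scale" "X = eps_class scale L1"
    "L2 \<in> full_lattices scale" "Y = eps_class scale L2"
    unfolding eps_classes_eq by blast
  then show "eps_mult scale X Y \<in> eps_classes scale"
    by (simp add: eps_classes_eq eps_mult_eps_class lat_mult_full_lattice)
  show "eps_mult scale X Y = eps_mult scale Y X"
    using L by (simp add: eps_mult_eps_class lat_mult_commute[of L1])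
  fix Z assume "Z \<in> eps_classes scale"
  then obtain L3 where "L3 \<in> full_lattices scale" "Z = eps_class scale L3"
    unfolding eps_classes_eq by blast
  with L show "eps_mult scale (eps_mult scale X Y) Z = eps_mult scale X (eps_mult scale Y Z)"
    by (simp add: eps_mult_eps_class lat_mult_full_lattice lat_mult_assoc)
qed

lemma unit_image_full_lattice:
  assumes L: "L \<in> full_lattices scale" and a: "a dvd 1"
  shows "(*) a ` L \<in> full_lattices scale"
proof -
  obtain a' where a': "a * a' = 1" using a by (metis dvdE)
  obtain B where B: "finite B" "L = int_module.span B" and sp: "span L = UNIV"
    using L unfolding full_lattices_def by blast
  have "(*) a ` L = int_module.span ((*) a ` B)"
  proof -
    interpret int_hom: module_hom "\<lambda>n::int. scale (of_int n)" "\<lambda>n::int. scale (of_int n)" "(*) a"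
      by unfold_locales (simp_all add: distrib_left scale_mult_right)
    show ?thesis unfolding B by (rule int_hom.span_image[symmetric])
  qed
  moreover have "span ((*) a ` L) = UNIV"
  proof -
    interpret hom: module_hom scale scale "(*) a"
      by unfold_locales (simp_all add: distrib_left scale_mult_right)
    have "x \<in> range ((*) a)" for x
      by (rule image_eqI[of _ _ "a' * x"]) (simp_all add: mult.assoc[symmetric] a')
    then show ?thesis unfolding hom.span_image sp by blast
  qed
  ultimately show ?thesis
    unfolding full_lattices_def using B(1) by blast
qed

text \<open>
  A product is determined only up to a unit \<open>a\<close> on the level of classes, but \<open>a (L X) = L (a X)\<close>, and
  \<open>a X\<close> is again a full lattice.
\<close>

lemma eps_divides_iff:
  assumes L: "L \<in> full_lattices scale" "L' \<in> full_lattices scale"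
  shows "(\<exists>Y\<in>eps_classes scale. eps_mult scale (eps_class scale L) Y = eps_class scale L') \<longleftrightarrow>
    (\<exists>X\<in>full_lattices scale. lat_mult L X = L')"
proof
  assume "\<exists>Y\<in>eps_classes scale. eps_mult scale (eps_class scale L) Y = eps_class scale L'"
  then obtain X where X: "X \<in> full_lattices scale"
    "eps_class scale (lat_mult L X) = eps_class scale L'"
    using L by (auto simp: eps_classes_eq eps_mult_eps_class)
  then obtain a where a: "a dvd 1" "(*) a ` lat_mult L X = L'"
    using L by (auto simp: eps_class_eq_iff lat_mult_full_lattice)
  have "lat_mult L ((*) a ` X) = L'"
    using lat_mult_image_left[of a X L] a(2) by (simp add: lat_mult_commute)
  then show "\<exists>X\<in>full_lattices scale. lat_mult L X = L'"
    using unit_image_full_lattice X(1) a(1) by blast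
next
  assume "\<exists>X\<in>full_lattices scale. lat_mult L X = L'"
  then show "\<exists>Y\<in>eps_classes scale. eps_mult scale (eps_class scale L) Y = eps_class scale L'"
    using L by (auto simp: eps_classes_eq eps_mult_eps_class)
qed

lemma sg_w_equiv_eps_class_iff:
  assumes L: "L \<in> full_lattices scale" "L' \<in> full_lattices scale"
  shows "sg_w_equiv (eps_classes scale) (eps_mult scale) (eps_class scale L) (eps_class scale L') \<longleftrightarrow>
    sg_w_equiv (full_lattices scale) lat_mult L L'"
proof -
  have refl: "\<exists>Y\<in>eps_classes scale. eps_mult scale (eps_class scale K) Y = eps_class scale K"
    if "K \<in> full_lattices scale" for K
    using eps_divides_iff[OF that that] sg_w_equiv_lat_iff[of K K] that
    by (auto simp: sg_w_equiv_def)
  have "sg_w_equiv (eps_classes scale) (eps_mult scale) (eps_class scale L) (eps_class scale L') \<longleftrightarrow>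
    (\<exists>Y\<in>eps_classes scale. eps_mult scale (eps_class scale L) Y = eps_class scale L') \<and>
    (\<exists>Y\<in>eps_classes scale. eps_mult scale (eps_class scale L') Y = eps_class scale L)"
    unfolding sg_w_equiv_def using L refl[OF L(1)] eps_classes_eq by (metis (no_types) imageI)
  also have "\<dots> \<longleftrightarrow> sg_w_equiv (full_lattices scale) lat_mult L L'"
    unfolding eps_divides_iff[OF L] eps_divides_iff[OF L(2,1)] sg_w_equiv_lat_iff
    using L by blast
  finally show ?thesis .
qed

text \<open>
  With this lemma, statements about groups and \<open>w\<close>-classes of \<open>\<epsilon>\<close>-classes become images of the ones about
  lattices.
\<close>

lemma sg_w_class_eps_class:
  assumes "L \<in> full_lattices scale"
  shows "sg_w_class (eps_classes scale) (eps_mult scale) (eps_class scale L) =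
    eps_class scale ` sg_w_class (full_lattices scale) lat_mult L"
proof -
  have in_full: "sg_w_class (full_lattices scale) lat_mult L \<subseteq> full_lattices scale"
    by (auto simp: sg_w_class_def sg_w_equiv_def)
  have in_classes: "sg_w_class (eps_classes scale) (eps_mult scale) (eps_class scale L)
      \<subseteq> eps_class scale ` full_lattices scale"
    by (auto simp: sg_w_class_def sg_w_equiv_def eps_classes_eq)
  have "eps_class scale K \<in> sg_w_class (eps_classes scale) (eps_mult scale) (eps_class scale L) \<longleftrightarrow>
      K \<in> sg_w_class (full_lattices scale) lat_mult L" if "K \<in> full_lattices scale" for K
    using that assms by (simp add: sg_w_class_def sg_w_equiv_eps_class_iff)
  with in_full in_classes show ?thesis by blast
qed

section \<open>The group of an order acts simply transitively on w-classes\<close>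

lemma lat_sg_group_eq_sg_w_class:
  assumes "L \<in> full_lattices scale"
  shows "sg_group (full_lattices scale) lat_mult (lat_order L) =
    sg_w_class (full_lattices scale) lat_mult (lat_order L)"
  using assms
  by (intro lat.sg_group_eq_sg_w_class lat_order_full_lattice lat_order_idem full_lattice_add_closed)

lemma eps_sg_group_eq_sg_w_class:
  assumes "L \<in> full_lattices scale"
  shows "sg_group (eps_classes scale) (eps_mult scale) (eps_class scale (lat_order L)) =
    sg_w_class (eps_classes scale) (eps_mult scale) (eps_class scale (lat_order L))"
  using assms
  by (intro eps.sg_group_eq_sg_w_class) (simp_all add: eps_classes_eq eps_mult_eps_class
      lat_order_full_lattice lat_order_idem full_lattice_add_closed)

lemma eps_sg_group_eq_image:
  assumes "L \<in> full_lattices scale"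
  shows "sg_group (eps_classes scale) (eps_mult scale) (eps_class scale (lat_order L)) =
    eps_class scale ` sg_group (full_lattices scale) lat_mult (lat_order L)"
  using assms by (simp add: eps_sg_group_eq_sg_w_class sg_w_class_eps_class lat_order_full_lattice
      lat_sg_group_eq_sg_w_class)

lemma sg_group_mult_inj:
  assumes "L1 \<in> full_lattices scale"
    and "L \<in> sg_group (full_lattices scale) lat_mult (lat_order L1)"
    and "L' \<in> sg_group (full_lattices scale) lat_mult (lat_order L1)"
    and "lat_mult L1 L = lat_mult L1 L'"
  shows "L = L'"
  using assms sg_group_eq_lat_quot by metis

lemma image_mult_sg_group:
  assumes L1: "L1 \<in> full_lattices scale"
  shows "(\<lambda>L3. lat_mult L3 L1) ` sg_group (full_lattices scale) lat_mult (lat_order L1) =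
    sg_w_class (full_lattices scale) lat_mult L1"
proof (intro set_eqI iffI)
  fix L2 assume "L2 \<in> (\<lambda>L3. lat_mult L3 L1) ` sg_group (full_lattices scale) lat_mult (lat_order L1)"
  then show "L2 \<in> sg_w_class (full_lattices scale) lat_mult L1"
    using sg_w_equiv_mult_sg_group[OF L1] lat_mult_commute[of L1] by (auto simp: sg_w_class_def)
next
  fix L2 assume "L2 \<in> sg_w_class (full_lattices scale) lat_mult L1"
  then obtain L3 where "L3 \<in> sg_group (full_lattices scale) lat_mult (lat_order L1)"
    "lat_mult L1 L3 = L2"
    using ex_sg_group_mult_eq unfolding sg_w_class_def by blast
  then show "L2 \<in> (\<lambda>L3. lat_mult L3 L1) ` sg_group (full_lattices scale) lat_mult (lat_order L1)"
    using lat_mult_commute[of L1 L3] by blast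
qed

lemma bij_betw_sg_group_sg_w_class:
  assumes "L1 \<in> full_lattices scale"
  shows "bij_betw (\<lambda>L3. lat_mult L3 L1)
    (sg_group (full_lattices scale) lat_mult (lat_order L1))
    (sg_w_class (full_lattices scale) lat_mult L1)"
  unfolding bij_betw_def image_mult_sg_group[OF assms]
  using sg_group_mult_inj[OF assms] by (simp add: inj_on_def lat_mult_commute[where ?L2.0 = L1])

text \<open>
  If \<open>[L][L\<^sub>1] = [L'][L\<^sub>1]\<close>, then \<open>(a L) L\<^sub>1 = L' L\<^sub>1\<close> for a unit \<open>a\<close>. As \<open>a L\<close> and \<open>L\<close> have the same class, \<open>a L\<close>
  also belongs to the group of the order, and injectivity on lattices gives \<open>a L = L'\<close>.
\<close>

lemma bij_betw_eps_sg_group_sg_w_class: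
  assumes L1: "L1 \<in> full_lattices scale"
  shows "bij_betw (\<lambda>X. eps_mult scale X (eps_class scale L1))
    (sg_group (eps_classes scale) (eps_mult scale) (eps_class scale (lat_order L1)))
    (sg_w_class (eps_classes scale) (eps_mult scale) (eps_class scale L1))"
proof -
  let ?G = "sg_group (full_lattices scale) lat_mult (lat_order L1)"
  have G_full: "L \<in> full_lattices scale" if "L \<in> ?G" for L
    using that by (simp add: lat.sg_group_iff)
  have G_scaled: "(*) a ` L \<in> ?G" if L: "L \<in> ?G" and a: "a dvd 1" for L a
  proof -
    have full: "L \<in> full_lattices scale" "(*) a ` L \<in> full_lattices scale"
      using L a G_full unit_image_full_lattice by auto
    then have "eps_class scale ((*) a ` L) = eps_class scale L"
      using a eps_class_eq_iff by metis
    then show ?thesis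
      using L full sg_w_equiv_eps_class_iff[OF lat_order_full_lattice[OF L1]]
      unfolding lat_sg_group_eq_sg_w_class[OF L1] sg_w_class_def by (metis mem_Collect_eq)
  qed
  have "inj_on (\<lambda>X. eps_mult scale X (eps_class scale L1)) (eps_class scale ` ?G)"
  proof (rule inj_onI, clarify)
    fix L L' assume L: "L \<in> ?G" "L' \<in> ?G"
      and "eps_mult scale (eps_class scale L) (eps_class scale L1) =
        eps_mult scale (eps_class scale L') (eps_class scale L1)"
    then have "eps_class scale (lat_mult L L1) = eps_class scale (lat_mult L' L1)"
      using G_full L1 by (simp add: eps_mult_eps_class)
    then obtain a where a: "a dvd 1" "(*) a ` lat_mult L L1 = lat_mult L' L1"
      using L G_full L1 by (auto simp: eps_class_eq_iff lat_mult_full_lattice)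
    then have "lat_mult L1 ((*) a ` L) = lat_mult L1 L'"
      by (metis lat_mult_commute lat_mult_image_left)
    then have "(*) a ` L = L'"
      using sg_group_mult_inj[OF L1] G_scaled L a(1) by blast
    then show "eps_class scale L = eps_class scale L'"
      using eps_class_eq_iff G_full L a(1) by blast
  qed
  moreover have "(\<lambda>X. eps_mult scale X (eps_class scale L1)) ` eps_class scale ` ?G =
      eps_class scale ` (\<lambda>L3. lat_mult L3 L1) ` ?G"
    unfolding image_image using G_full L1 by (intro image_cong refl) (simp add: eps_mult_eps_class)
  ultimately show ?thesis
    unfolding bij_betw_def eps_sg_group_eq_image[OF L1] sg_w_class_eps_class[OF L1]
    by (simp only: image_mult_sg_group[OF L1] simp_thms)
qed

end

theorem theorem5p8:
  fixes scale :: "rat \<Rightarrow> 'a::{comm_ring, comm_monoid_mult} \<Rightarrow> 'a"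
  assumes "fin_dim_comm_rat_algebra scale"
  shows "(\<forall>L1\<in>full_lattices scale. \<forall>L2\<in>full_lattices scale.
            sg_w_equiv (full_lattices scale) lat_mult L1 L2 \<longrightarrow>
              lat_order L1 = lat_order L2 \<and>
              {L3 \<in> full_lattices scale.
                 lat_mult L1 L3 = L2 \<and>
                 L3 \<in> sg_group (full_lattices scale) lat_mult (lat_order L1)} = {lat_quot L2 L1})
       \<and> (\<forall>\<Lambda> L1. is_order scale \<Lambda> \<and> L1 \<in> full_lattices scale \<and> lat_order L1 = \<Lambda> \<longrightarrow>
            sg_group (full_lattices scale) lat_mult \<Lambda> =
              sg_w_class (full_lattices scale) lat_mult \<Lambda> \<and>
            sg_group (eps_classes scale) (eps_mult scale) (eps_class scale \<Lambda>) =
              sg_w_class (eps_classes scale) (eps_mult scale) (eps_class scale \<Lambda>) \<and>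
            bij_betw (\<lambda>L3. lat_mult L3 L1)
              (sg_group (full_lattices scale) lat_mult \<Lambda>)
              (sg_w_class (full_lattices scale) lat_mult L1) \<and>
            bij_betw (\<lambda>X. eps_mult scale X (eps_class scale L1))
              (sg_group (eps_classes scale) (eps_mult scale) (eps_class scale \<Lambda>))
              (sg_w_class (eps_classes scale) (eps_mult scale) (eps_class scale L1)))"
proof -
  interpret fin_dim_comm_rat_algebra scale by (rule assms)
  show ?thesis
  proof (intro conjI allI ballI impI; (elim conjE)?)
    fix L1 L2 assume L: "L1 \<in> full_lattices scale" "L2 \<in> full_lattices scale"
      and w: "sg_w_equiv (full_lattices scale) lat_mult L1 L2"
    show "lat_order L1 = lat_order L2"
      by (rule lat_order_eq_if_w_equiv[OF w])
    obtain L3 where L3: "L3 \<in> sg_group (full_lattices scale) lat_mult (lat_order L1)"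
      "lat_mult L1 L3 = L2"
      using ex_sg_group_mult_eq[OF w] by blast
    moreover have "K = lat_quot L2 L1"
      if "K \<in> sg_group (full_lattices scale) lat_mult (lat_order L1)" "lat_mult L1 K = L2" for K
      using sg_group_eq_lat_quot[OF L(1) that(1)] that(2) by simp
    moreover have "L3 \<in> full_lattices scale"
      using L3(1) by (simp add: lat.sg_group_iff)
    ultimately show "{L3 \<in> full_lattices scale. lat_mult L1 L3 = L2 \<and>
        L3 \<in> sg_group (full_lattices scale) lat_mult (lat_order L1)} = {lat_quot L2 L1}"
      by (intro subset_antisym subsetI) auto
  next
    fix \<Lambda> L1 assume "L1 \<in> full_lattices scale" "lat_order L1 = \<Lambda>"
    then show "sg_group (full_lattices scale) lat_mult \<Lambda> =
        sg_w_class (full_lattices scale) lat_mult \<Lambda>"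
      "sg_group (eps_classes scale) (eps_mult scale) (eps_class scale \<Lambda>) =
        sg_w_class (eps_classes scale) (eps_mult scale) (eps_class scale \<Lambda>)"
      "bij_betw (\<lambda>L3. lat_mult L3 L1)
        (sg_group (full_lattices scale) lat_mult \<Lambda>)
        (sg_w_class (full_lattices scale) lat_mult L1)"
      "bij_betw (\<lambda>X. eps_mult scale X (eps_class scale L1))
        (sg_group (eps_classes scale) (eps_mult scale) (eps_class scale \<Lambda>))
        (sg_w_class (eps_classes scale) (eps_mult scale) (eps_class scale L1))"
      using lat_sg_group_eq_sg_w_class eps_sg_group_eq_sg_w_class
        bij_betw_sg_group_sg_w_class bij_betw_eps_sg_group_sg_w_class by auto
  qed
qed

end
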